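(* Let $\{\alpha_i : i=1,2,\dots\}$ be a sequence of real numbers and let $\{\lambda_i\}_{i\in\mathbb{N}}$ be a sequence of numbers $\lambda_i\ge 0$ with $\lambda=\sup\{\lambda_i : i\ge 1\}<\infty$. For each $N\in\mathbb{N}$ with $N>\lambda$, let $(\mathcal{A}_N,\varphi_N)$ be a $C^*$-probability space containing $N$ freely independent and identically distributed sequences $$\{p_{1,N}^{(i)}\}_{i\in\mathbb{N}},\ \{p_{2,N}^{(i)}\}_{i\in\mathbb{N}},\ \dots,\ \{p_{N,N}^{(i)}\}_{i\in\mathbb{N}}$$ of commuting projections, i.e. $p_{j,N}^{(i(1))}p_{j,N}^{(i(2))}=p_{j,N}^{(i(2))}p_{j,N}^{(i(1))}$ for all $i(1),i(2)\in\mathbb{N}$ and $1\le j\le N$, such that $\varphi_N(p_{r,N}^{(i)})=\frac{\lambda_i}{N}$ for all $i\in\mathbb{N}$ and $r=1,\dots,N$. Put $a_{j,N}^{(i)}=\alpha_i p_{j,N}^{(i)}$ for $i\in\mathbb{N}$, $1\le j\le N$. Then there exist a family of random variables $(b_i)_{i\in\mathbb{N}}$ in a non-commutative probability space $(\mathcal{A},\varphi)$ and a sequence $\{n_k : k=1,2,\dots\}$ of natural numbers with $\lim_{k\to\infty}n_k=\infty$ such that $$\bigl(a_{1,n_k}^{(i)}+a_{2,n_k}^{(i)}+\cdots+a_{n_k,n_k}^{(i)}\bigr)_{i\in\mathbb{N}}$$ converges in distribution to $(b_i)_{i\in\mathbb{N}}$ as $k\to\infty$.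
   Context: A non-commutative probability space $(\mathcal{A},\varphi)$ is a unital complex algebra $\mathcal{A}$ with a linear functional $\varphi$ satisfying $\varphi(1)=1$. A $C^*$-probability space is a unital $C^*$-algebra with a state. Sequences (families) are freely independent if the unital subalgebras they generate are freely independent; subalgebras $\mathcal{A}_i$ are freely independent if $\varphi(a_1\cdots a_n)=0$ whenever $a_j\in\mathcal{A}_{l(j)}$, $\varphi(a_j)=0$ for all $j$, and $l(j)\ne l(j+1)$ for $1\le j\le n-1$. Sequences are identically distributed if they have the same joint moments. A sequence of families $(c_{k}^{(i)})_{i\in\mathbb{N}}$ in non-commutative probability spaces $(\mathcal{C}_k,\psi_k)$ converges in distribution to $(b_i)_{i\in\mathbb{N}}$ in $(\mathcal{A},\varphi)$ if $\psi_k(c_k^{(i(1))}\cdots c_k^{(i(n))})\to\varphi(b_{i(1)}\cdots b_{i(n)})$ as $k\to\infty$ for all $n\ge1$ and all $i(1),\dots,i(n)\in\mathbb{N}$. *)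

theory Defs
  imports "HOL-Analysis.Analysis" "HOL-Algebra.Algebraic_Closure_Type" "HOL-Algebra.Subrings"
begin

text \<open>
  Algebras are carrier-based (HOL-Algebra style), so that a sequence of different algebras can be
  written as one function from the natural numbers. The locale \<^verbatim>\<open>module\<close> of HOL-Algebra requires only an
  abelian group, whereas its locale \<^verbatim>\<open>algebra\<close> requires commutativity and is therefore not used.
\<close>

abbreviation complex_ring :: "complex ring"
  where "complex_ring \<equiv> ring_of_type_algebra"

locale unital_complex_algebra = Module.module complex_ring A + Ring.ring A
  for A :: "(complex, 'a, 'm) module_scheme" (structure) +
  assumes smult_mult_left:
      "\<lbrakk>x \<in> carrier A; y \<in> carrier A\<rbrakk> \<Longrightarrow> (c \<odot>\<^bsub>A\<^esub> x) \<otimes>\<^bsub>A\<^esub> y = c \<odot>\<^bsub>A\<^esub> (x \<otimes>\<^bsub>A\<^esub> y)"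
    and smult_mult_right:
      "\<lbrakk>x \<in> carrier A; y \<in> carrier A\<rbrakk> \<Longrightarrow> x \<otimes>\<^bsub>A\<^esub> (c \<odot>\<^bsub>A\<^esub> y) = c \<odot>\<^bsub>A\<^esub> (x \<otimes>\<^bsub>A\<^esub> y)"

locale nc_probability_space = unital_complex_algebra A
  for A :: "(complex, 'a, 'm) module_scheme" (structure) and \<phi> :: "'a \<Rightarrow> complex" +
  assumes functional_add:
      "\<lbrakk>x \<in> carrier A; y \<in> carrier A\<rbrakk> \<Longrightarrow> \<phi> (x \<oplus>\<^bsub>A\<^esub> y) = \<phi> x + \<phi> y"
    and functional_smult: "x \<in> carrier A \<Longrightarrow> \<phi> (c \<odot>\<^bsub>A\<^esub> x) = c * \<phi> x"
    and functional_one: "\<phi> \<one>\<^bsub>A\<^esub> = 1"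

record 'a cstar_record = "(complex, 'a) module" +
  star :: "'a \<Rightarrow> 'a"
  cnorm :: "'a \<Rightarrow> real"

locale unital_cstar_algebra = unital_complex_algebra A
  for A :: "('a, 'm) cstar_record_scheme" (structure) +
  assumes star_closed: "x \<in> carrier A \<Longrightarrow> star A x \<in> carrier A"
    and star_star: "x \<in> carrier A \<Longrightarrow> star A (star A x) = x"
    and star_add:
      "\<lbrakk>x \<in> carrier A; y \<in> carrier A\<rbrakk> \<Longrightarrow> star A (x \<oplus>\<^bsub>A\<^esub> y) = star A x \<oplus>\<^bsub>A\<^esub> star A y"
    and star_smult: "x \<in> carrier A \<Longrightarrow> star A (c \<odot>\<^bsub>A\<^esub> x) = cnj c \<odot>\<^bsub>A\<^esub> star A x"
    and star_mult:
      "\<lbrakk>x \<in> carrier A; y \<in> carrier A\<rbrakk> \<Longrightarrow> star A (x \<otimes>\<^bsub>A\<^esub> y) = star A y \<otimes>\<^bsub>A\<^esub> star A x"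
    and cnorm_nonneg: "x \<in> carrier A \<Longrightarrow> 0 \<le> cnorm A x"
    and cnorm_eq_zero: "x \<in> carrier A \<Longrightarrow> cnorm A x = 0 \<longleftrightarrow> x = \<zero>\<^bsub>A\<^esub>"
    and cnorm_triangle:
      "\<lbrakk>x \<in> carrier A; y \<in> carrier A\<rbrakk> \<Longrightarrow> cnorm A (x \<oplus>\<^bsub>A\<^esub> y) \<le> cnorm A x + cnorm A y"
    and cnorm_smult: "x \<in> carrier A \<Longrightarrow> cnorm A (c \<odot>\<^bsub>A\<^esub> x) = cmod c * cnorm A x"
    and cnorm_mult:
      "\<lbrakk>x \<in> carrier A; y \<in> carrier A\<rbrakk> \<Longrightarrow> cnorm A (x \<otimes>\<^bsub>A\<^esub> y) \<le> cnorm A x * cnorm A y"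
    and cnorm_star_mult: "x \<in> carrier A \<Longrightarrow> cnorm A (star A x \<otimes>\<^bsub>A\<^esub> x) = (cnorm A x)\<^sup>2"
    and complete:
      "\<lbrakk>range s \<subseteq> carrier A;
        \<forall>e>0. \<exists>M. \<forall>m\<ge>M. \<forall>n\<ge>M. cnorm A (s m \<ominus>\<^bsub>A\<^esub> s n) < e\<rbrakk>
       \<Longrightarrow> \<exists>x\<in>carrier A. (\<lambda>n. cnorm A (s n \<ominus>\<^bsub>A\<^esub> x)) \<longlonglongrightarrow> 0"

text \<open>A state is a positive linear functional with value 1 at the unit; boundedness is automatic.\<close>

locale cstar_probability_space = unital_cstar_algebra A + nc_probability_space A \<phi>
  for A :: "('a, 'm) cstar_record_scheme" (structure) and \<phi> :: "'a \<Rightarrow> complex" +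
  assumes positive: "x \<in> carrier A \<Longrightarrow> \<phi> (star A x \<otimes>\<^bsub>A\<^esub> x) \<in> \<real>\<^sub>\<ge>\<^sub>0"

definition projection :: "('a, 'm) cstar_record_scheme \<Rightarrow> 'a \<Rightarrow> bool"
  where "projection A p \<longleftrightarrow> p \<in> carrier A \<and> p \<otimes>\<^bsub>A\<^esub> p = p \<and> star A p = p"

definition list_prod :: "('a, 'm) monoid_scheme \<Rightarrow> 'a list \<Rightarrow> 'a"
  where "list_prod A xs = foldr (\<otimes>\<^bsub>A\<^esub>) xs \<one>\<^bsub>A\<^esub>"

definition unital_subalgebra :: "(complex, 'a, 'm) module_scheme \<Rightarrow> 'a set \<Rightarrow> bool"
  where "unital_subalgebra A H \<longleftrightarrow> subring H A \<and> submodule H complex_ring A"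

definition generated_subalgebra :: "(complex, 'a, 'm) module_scheme \<Rightarrow> 'a set \<Rightarrow> 'a set"
  where "generated_subalgebra A S = \<Inter> {H. unital_subalgebra A H \<and> S \<subseteq> H}"

text \<open>
  The list \<^verbatim>\<open>ls\<close> holds the indices of the subalgebras containing the factors \<^verbatim>\<open>xs\<close>; only
  neighbouring indices have to differ.
\<close>

definition free_subalgebras ::
    "(complex, 'a, 'm) module_scheme \<Rightarrow> ('a \<Rightarrow> complex) \<Rightarrow> 'j set \<Rightarrow> ('j \<Rightarrow> 'a set) \<Rightarrow> bool"
  where "free_subalgebras A \<phi> J H \<longleftrightarrow>
    (\<forall>ls xs. xs \<noteq> [] \<and> list_all2 (\<lambda>l x. l \<in> J \<and> x \<in> H l \<and> \<phi> x = 0) ls xs \<and> distinct_adj ls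
       \<longrightarrow> \<phi> (list_prod A xs) = 0)"

definition free_families ::
    "(complex, 'a, 'm) module_scheme \<Rightarrow> ('a \<Rightarrow> complex) \<Rightarrow> 'j set \<Rightarrow> ('j \<Rightarrow> 'i \<Rightarrow> 'a) \<Rightarrow> bool"
  where "free_families A \<phi> J c \<longleftrightarrow>
    free_subalgebras A \<phi> J (\<lambda>j. generated_subalgebra A (range (c j)))"

definition joint_moment ::
    "('a, 'm) monoid_scheme \<Rightarrow> ('a \<Rightarrow> complex) \<Rightarrow> ('i \<Rightarrow> 'a) \<Rightarrow> 'i list \<Rightarrow> complex"
  where "joint_moment A \<phi> c is = \<phi> (list_prod A (map c is))"

definition identically_distributed ::
    "('a, 'm) monoid_scheme \<Rightarrow> ('a \<Rightarrow> complex) \<Rightarrow> 'j set \<Rightarrow> ('j \<Rightarrow> 'i \<Rightarrow> 'a) \<Rightarrow> bool"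
  where "identically_distributed A \<phi> J c \<longleftrightarrow>
    (\<forall>j\<in>J. \<forall>j'\<in>J. \<forall>is. is \<noteq> [] \<longrightarrow> joint_moment A \<phi> (c j) is = joint_moment A \<phi> (c j') is)"

definition converges_in_distribution ::
    "(nat \<Rightarrow> ('c, 'm) monoid_scheme) \<Rightarrow> (nat \<Rightarrow> 'c \<Rightarrow> complex) \<Rightarrow> (nat \<Rightarrow> 'i \<Rightarrow> 'c) \<Rightarrow>
     ('b, 'n) monoid_scheme \<Rightarrow> ('b \<Rightarrow> complex) \<Rightarrow> ('i \<Rightarrow> 'b) \<Rightarrow> bool"
  where "converges_in_distribution C \<psi> c B \<phi> b \<longleftrightarrow>
    (\<forall>is. is \<noteq> [] \<longrightarrow>
       (\<lambda>k. joint_moment (C k) (\<psi> k) (c k) is) \<longlonglongrightarrow> joint_moment B \<phi> b is)"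

text \<open>
  A statement can assert the existence of an algebra only on a named type. Coefficient functions on
  words are large enough: each joint distribution of a sequence is realised on the algebra of
  polynomials in countably many noncommuting indeterminates, i.e. on the functions of finite support.
\<close>

type_synonym nc_polynomial = "nat list \<Rightarrow> complex"

end

theory Submission
  imports Defs "HOL-Complex_Analysis.Great_Picard"
begin

text \<open>
  Two facts give the theorem. Each joint moment of the sums stays bounded as \<open>N\<close> grows, and any
  bounded family of moments, indexed by the countable set of words, has a subsequence along which all
  of them converge. The limits then define a functional on the free algebra whose indeterminates
  are the desired random variables. Such a functional is linear by construction, and it takes the
  value \<open>1\<close> at the unit because all the moments of the empty word are \<open>1\<close>.

  The bound needs a power of \<open>1 / N\<close> to compensate for the \<open>N ^ n\<close> terms in the expansion of a
  product of \<open>n\<close> sums. Call the index \<open>j\<close> of a family \<open>p j\<close> its colour, and put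
  \<open>\<epsilon> = L / N\<close>. In one colour, a nonempty product of commuting projections is a projection below
  each of its factors, hence has expectation at most \<open>\<epsilon>\<close> by positivity. Freeness propagates this to
  words with several colours: a product of \<open>n\<close> such monomials using \<open>r\<close> different colours has
  expectation at most \<open>2 ^ (n * n) * \<epsilon> ^ r\<close> (\<open>functional_word_le\<close>). Indeed neighbours of
  equal colour can be merged into one monomial. If no neighbours agree, the product of the centred
  factors has expectation \<open>0\<close>, and replacing the centred factors one by one by the original ones
  costs terms in which some factors are taken out as scalars of size at most \<open>\<epsilon>\<close>; these
  terms are shorter words that lose at most one colour for each factor taken out, so induction on
  the length applies (\<open>functional_centring_error\<close>).

  Since about \<open>N ^ r\<close> index tuples use \<open>r\<close> colours and \<open>N * \<epsilon> = L\<close>, the moments of the sums are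
  bounded independently of \<open>N\<close> (\<open>joint_moment_weighted_sum_le\<close>).
\<close>

lemma complex_ring_simps [simp]:
  "carrier complex_ring = UNIV" "\<one>\<^bsub>complex_ring\<^esub> = 1" "\<zero>\<^bsub>complex_ring\<^esub> = 0"
  "x \<otimes>\<^bsub>complex_ring\<^esub> y = x * y" "x \<oplus>\<^bsub>complex_ring\<^esub> y = x + y"
  by (auto simp: ring_of_type_algebra_def)

lemma list_prod_Nil [simp]: "list_prod A [] = \<one>\<^bsub>A\<^esub>"
  and list_prod_Cons [simp]: "list_prod A (x # xs) = x \<otimes>\<^bsub>A\<^esub> list_prod A xs"
  by (simp_all add: list_prod_def)

section \<open>The free algebra on a sequence of indeterminates\<close>

text \<open>
  The multiplication of the free algebra: the value at \<open>w\<close> is the sum of \<open>f u * g v\<close> over all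
  factorisations \<open>w = u @ v\<close>. Separating the factorisation with empty \<open>u\<close> from the others makes it a
  recursion on \<open>w\<close> in which only \<open>f\<close> changes, to the part of \<open>f\<close> that begins with a given letter.
  The ring laws then follow by induction on the word, without any reindexing of sums.
\<close>

fun word_conv :: "nc_polynomial \<Rightarrow> nc_polynomial \<Rightarrow> nc_polynomial" where
  "word_conv f g [] = f [] * g []"
| "word_conv f g (x # w) = f [] * g (x # w) + word_conv (\<lambda>u. f (x # u)) g w"

lemma word_conv_add_left: "word_conv (\<lambda>u. f u + f' u) g w = word_conv f g w + word_conv f' g w"
  by (induction w arbitrary: f f') (simp_all add: algebra_simps)

lemma word_conv_add_right: "word_conv f (\<lambda>u. g u + g' u) w = word_conv f g w + word_conv f g' w"
  by (induction w arbitrary: f) (simp_all add: algebra_simps)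

lemma word_conv_smult_left: "word_conv (\<lambda>u. c * f u) g w = c * word_conv f g w"
  by (induction w arbitrary: f) (simp_all add: algebra_simps)

lemma word_conv_smult_right: "word_conv f (\<lambda>u. c * g u) w = c * word_conv f g w"
  by (induction w arbitrary: f) (simp_all add: algebra_simps)

lemma word_conv_assoc: "word_conv (word_conv f g) h w = word_conv f (word_conv g h) w"
  by (induction w arbitrary: f g)
     (simp_all add: word_conv_add_left word_conv_smult_left algebra_simps)

lemma word_conv_zero_left: "word_conv (\<lambda>u. 0) g w = 0"
  by (induction w) simp_all

lemma word_conv_one_right: "word_conv f (\<lambda>u. if u = [] then 1 else 0) w = f w"
  by (induction w arbitrary: f) simp_all

lemma word_conv_one_left: "word_conv (\<lambda>u. if u = [] then 1 else 0) g w = g w"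
  by (cases w) (simp_all add: word_conv_zero_left)

lemma word_conv_letter_left:
  "word_conv (\<lambda>u. if u = [i] then 1 else 0) (\<lambda>u. if u = v then 1 else 0) w =
    (if w = i # v then 1 else 0)"
proof (cases w)
  case (Cons x u)
  then show ?thesis
    by (cases "x = i") (auto simp: word_conv_zero_left word_conv_one_left)
qed simp

lemma word_conv_support:
  "word_conv f g w \<noteq> 0 \<Longrightarrow> \<exists>u v. w = u @ v \<and> f u \<noteq> 0 \<and> g v \<noteq> 0"
proof (induction w arbitrary: f)
  case (Cons x w)
  show ?case
  proof (cases "f [] * g (x # w) = 0")
    case True
    with Cons.prems have "word_conv (\<lambda>u. f (x # u)) g w \<noteq> 0" by auto
    from Cons.IH[OF this] obtain u v where "w = u @ v" "f (x # u) \<noteq> 0" "g v \<noteq> 0" by blast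
    then show ?thesis by (intro exI[of _ "x # u"] exI[of _ v]) simp
  qed (intro exI[of _ "[]"] exI[of _ "x # w"], auto)
qed auto

definition free_algebra :: "(complex, nc_polynomial) module" where
  "free_algebra =
    \<lparr>carrier = {f. finite {w. f w \<noteq> 0}},
     monoid.mult = word_conv,
     one = (\<lambda>w. if w = [] then 1 else 0),
     ring.zero = (\<lambda>w. 0),
     add = (\<lambda>f g w. f w + g w),
     smult = (\<lambda>c f w. c * f w)\<rparr>"

definition indeterminate :: "nat \<Rightarrow> nc_polynomial" where
  "indeterminate i = (\<lambda>w. if w = [i] then 1 else 0)"

text \<open>
  The linear extension of a function on words, i.e. on the monomials that form a basis.
\<close>

definition moment_functional :: "(nat list \<Rightarrow> complex) \<Rightarrow> nc_polynomial \<Rightarrow> complex" where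
  "moment_functional m f = (\<Sum>w | f w \<noteq> 0. f w * m w)"

lemma finite_support_word_conv:
  assumes "finite {w. f w \<noteq> 0}" "finite {w. g w \<noteq> 0}"
  shows "finite {w. word_conv f g w \<noteq> 0}"
proof (rule finite_subset)
  show "{w. word_conv f g w \<noteq> 0} \<subseteq> (\<lambda>(u, v). u @ v) ` ({w. f w \<noteq> 0} \<times> {w. g w \<noteq> 0})"
    using word_conv_support by fastforce
qed (use assms in simp)

lemma finite_support_add:
  fixes f g :: nc_polynomial
  assumes "finite {w. f w \<noteq> 0}" "finite {w. g w \<noteq> 0}"
  shows "finite {w. f w + g w \<noteq> 0}"
  by (rule finite_subset[of _ "{w. f w \<noteq> 0} \<union> {w. g w \<noteq> 0}"]) (use assms in auto)

lemma finite_support_smult: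
  fixes f :: nc_polynomial
  assumes "finite {w. f w \<noteq> 0}"
  shows "finite {w. c * f w \<noteq> 0}"
  by (rule finite_subset[OF _ assms]) auto

lemma unital_complex_algebra_free_algebra: "unital_complex_algebra free_algebra"
proof -
  have ag: "abelian_group free_algebra"
  proof (rule abelian_groupI)
    fix f assume f: "f \<in> carrier free_algebra"
    show "\<exists>g\<in>carrier free_algebra. g \<oplus>\<^bsub>free_algebra\<^esub> f = \<zero>\<^bsub>free_algebra\<^esub>"
      by (rule bexI[of _ "\<lambda>w. - f w"]) (use f in \<open>auto simp: free_algebra_def\<close>)
  qed (auto simp: free_algebra_def finite_support_add algebra_simps)
  moreover have "monoid free_algebra"
    by (rule monoidI)
       (auto simp: free_algebra_def finite_support_word_conv word_conv_assoc
          word_conv_one_left word_conv_one_right)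
  ultimately have ring: "ring free_algebra"
    by (rule ringI)
       (auto simp: free_algebra_def word_conv_add_left word_conv_add_right)
  have "Module.module complex_ring free_algebra"
    by (rule moduleI[OF _ ag])
       (auto simp: free_algebra_def finite_support_smult algebra_simps
             intro!: cring_from_type_algebra)
  with ring show ?thesis
    by (auto simp: unital_complex_algebra_def unital_complex_algebra_axioms_def free_algebra_def
        word_conv_smult_left word_conv_smult_right)
qed

text \<open>
  Two polynomials can only be added termwise over a common set containing both supports.
\<close>

lemma moment_functional_eq_sum:
  assumes "finite S" "{w. f w \<noteq> 0} \<subseteq> S"
  shows "moment_functional m f = (\<Sum>w\<in>S. f w * m w)"
  unfolding moment_functional_def by (rule sum.mono_neutral_left) (use assms in auto)

lemma nc_probability_space_free_algebra:
  assumes "m [] = 1"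
  shows "nc_probability_space free_algebra (moment_functional m)"
proof -
  have add: "moment_functional m (\<lambda>w. f w + g w) = moment_functional m f + moment_functional m g"
    if f: "finite {w. f w \<noteq> 0}" and g: "finite {w. g w \<noteq> 0}" for f g
  proof -
    let ?S = "{w. f w \<noteq> 0} \<union> {w. g w \<noteq> 0}"
    have "moment_functional m h = (\<Sum>w\<in>?S. h w * m w)" if "{w. h w \<noteq> 0} \<subseteq> ?S" for h
      by (rule moment_functional_eq_sum) (use f g that in auto)
    moreover have "{w. f w + g w \<noteq> 0} \<subseteq> ?S" by auto
    ultimately show ?thesis
      by (auto simp: sum.distrib[symmetric] algebra_simps)
  qed
  have smult: "moment_functional m (\<lambda>w. c * f w) = c * moment_functional m f"
    if "finite {w. f w \<noteq> 0}" for c f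
    using moment_functional_eq_sum[OF that, of "\<lambda>w. c * f w" m]
    by (auto simp: moment_functional_def sum_distrib_left mult.assoc)
  have one: "moment_functional m (\<lambda>w. if w = [] then 1 else 0) = 1"
    using assms moment_functional_eq_sum[of "{[]}" "\<lambda>w. if w = [] then 1 else 0" m] by simp
  show ?thesis
    by (intro nc_probability_space.intro nc_probability_space_axioms.intro
          unital_complex_algebra_free_algebra)
       (auto simp: free_algebra_def add smult one)
qed

lemma indeterminate_in_carrier: "indeterminate i \<in> carrier free_algebra"
  by (simp add: indeterminate_def free_algebra_def)

text \<open>
  Hence every function on words with value \<open>1\<close> at the empty word is a joint distribution.
\<close>

lemma joint_moment_indeterminate:
  "joint_moment free_algebra (moment_functional m) indeterminate is = m is"
proof -
  have "list_prod free_algebra (map indeterminate is) = (\<lambda>w. if w = is then 1 else 0)"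
  proof (induction "is")
    case (Cons i "is")
    then show ?case
      by (auto simp: free_algebra_def indeterminate_def word_conv_letter_left)
  qed (simp add: free_algebra_def)
  then show ?thesis
    using moment_functional_eq_sum[of "{is}" "\<lambda>w. if w = is then 1 else 0" m]
    by (simp add: joint_moment_def)
qed

section \<open>Moments of free families of small commuting projections\<close>

context unital_complex_algebra
begin

lemma list_prod_closed: "set xs \<subseteq> carrier A \<Longrightarrow> list_prod A xs \<in> carrier A"
  by (induction xs) auto

lemma list_prod_append:
  "set xs \<subseteq> carrier A \<Longrightarrow> set ys \<subseteq> carrier A \<Longrightarrow>
    list_prod A (xs @ ys) = list_prod A xs \<otimes> list_prod A ys"
  by (induction xs) (auto simp: list_prod_closed m_assoc)

end

context nc_probability_space
begin

lemma functional_zero: "\<phi> \<zero> = 0"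
  using functional_add[of \<zero> \<zero>] by simp

lemma functional_minus:
  assumes "x \<in> carrier A" "y \<in> carrier A"
  shows "\<phi> (x \<ominus> y) = \<phi> x - \<phi> y"
proof -
  have "(x \<ominus> y) \<oplus> y = x" using assms by (simp add: minus_eq a_assoc l_neg)
  then show ?thesis using functional_add[of "x \<ominus> y" y] assms by simp
qed

lemma functional_finsum:
  assumes "finite J" "\<And>j. j \<in> J \<Longrightarrow> f j \<in> carrier A"
  shows "\<phi> (\<Oplus>j\<in>J. f j) = (\<Sum>j\<in>J. \<phi> (f j))"
  using assms by (induction J rule: finite_induct) (auto simp: functional_zero functional_add)

end


context cstar_probability_space
begin

lemma star_one: "star A \<one> = \<one>"
proof -
  have "\<one> = star A (star A \<one> \<otimes> \<one>)"
    by (simp add: star_star star_closed)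
  also have "\<dots> = star A \<one>"
    by (subst star_mult) (simp_all add: star_star star_closed)
  finally show ?thesis by simp
qed

lemma projection_one: "projection A \<one>"
  by (simp add: projection_def star_one)

lemma projection_mult:
  assumes "projection A p" "projection A q" "p \<otimes> q = q \<otimes> p"
  shows "projection A (p \<otimes> q)"
proof -
  have [simp]: "p \<in> carrier A" "q \<in> carrier A" and idem: "p \<otimes> p = p" "q \<otimes> q = q"
    using assms by (auto simp: projection_def)
  have "(p \<otimes> q) \<otimes> (p \<otimes> q) = p \<otimes> (q \<otimes> p) \<otimes> q"
    by (simp add: m_assoc)
  also have "\<dots> = (p \<otimes> p) \<otimes> (q \<otimes> q)"
    by (simp only: assms(3)[symmetric]) (simp add: m_assoc)
  finally show ?thesis
    using assms by (simp add: projection_def star_mult idem)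
qed

lemma projection_functional_nonneg:
  assumes "projection A p"
  shows "\<phi> p \<in> \<real>\<^sub>\<ge>\<^sub>0"
  using positive[of p] assms by (auto simp: projection_def)

lemma projection_minus:
  assumes p: "projection A p" and q: "projection A q" and "p \<otimes> q = q" "q \<otimes> p = q"
  shows "projection A (p \<ominus> q)"
proof -
  have [simp]: "p \<in> carrier A" "q \<in> carrier A"
    and idem: "p \<otimes> p = p" "q \<otimes> q = q" and star: "star A p = p" "star A q = q"
    using p q by (auto simp: projection_def)
  define x where "x = p \<ominus> q"
  have x [simp]: "x \<in> carrier A" and sum: "x \<oplus> q = p"
    by (simp_all add: x_def minus_eq a_assoc l_neg)
  have "star A x \<oplus> q = x \<oplus> q"
    using star_add[of x q] sum star by simp
  then have "star A x = x"
    by (simp add: star_closed add.right_cancel)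
  moreover have "x \<otimes> x = x"
    by (simp add: x_def minus_eq l_distr r_distr l_minus r_minus idem assms(3,4) minus_minus
        a_assoc r_neg l_neg)
  ultimately show ?thesis by (simp add: projection_def x_def[symmetric])
qed

text \<open>
  The hypotheses say that \<open>q\<close> lies below \<open>p\<close>. Their difference is then a projection, so positivity
  of the state applies to it.
\<close>

lemma projection_functional_mono:
  assumes "projection A p" "projection A q" "p \<otimes> q = q" "q \<otimes> p = q"
  shows "cmod (\<phi> q) \<le> Re (\<phi> p)"
proof -
  have "\<phi> p - \<phi> q \<in> \<real>\<^sub>\<ge>\<^sub>0"
    using projection_functional_nonneg[OF projection_minus[OF assms]] assms
    by (simp add: functional_minus projection_def)
  moreover have "\<phi> q \<in> \<real>\<^sub>\<ge>\<^sub>0"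
    by (rule projection_functional_nonneg) fact
  ultimately show ?thesis
    by (auto simp: complex_nonneg_Reals_iff cmod_eq_Re)
qed

end

text \<open>
  The indices in \<open>J\<close> are the colours. The parameter \<open>\<epsilon>\<close> bounds all expectations; in the theorem it
  is \<open>L / N\<close>, with \<open>N\<close> colours.
\<close>

locale small_free_projections = cstar_probability_space A \<phi>
  for A :: "('a, 'm) cstar_record_scheme" (structure) and \<phi> +
  fixes J :: "'j set" and p :: "'j \<Rightarrow> 'i \<Rightarrow> 'a" and \<epsilon> :: real
  assumes proj: "j \<in> J \<Longrightarrow> projection A (p j i)"
    and commute: "j \<in> J \<Longrightarrow> p j i \<otimes> p j i' = p j i' \<otimes> p j i"
    and free: "free_families A \<phi> J p"
    and eps_nonneg: "0 \<le> \<epsilon>" and eps_le_one: "\<epsilon> \<le> 1"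
    and small: "j \<in> J \<Longrightarrow> Re (\<phi> (p j i)) \<le> \<epsilon>"
begin

text \<open>
  A product of projections of one colour is represented by the colour together with the list of the
  indices of its factors. Words are lists of such pairs, so that merging two neighbouring monomials
  of the same colour is an operation on the representation.
\<close>

definition monomial :: "'j \<times> 'i list \<Rightarrow> 'a" where
  "monomial l = list_prod A (map (p (fst l)) (snd l))"

text \<open>
  Empty monomials are excluded because the unit does not have a small expectation.
\<close>

definition coloured_word :: "('j \<times> 'i list) list \<Rightarrow> bool" where
  "coloured_word ws \<longleftrightarrow> (\<forall>l\<in>set ws. fst l \<in> J \<and> snd l \<noteq> [])"

definition word_prod :: "('j \<times> 'i list) list \<Rightarrow> 'a" where
  "word_prod ws = list_prod A (map monomial ws)"

definition colours :: "('j \<times> 'i list) list \<Rightarrow> nat" where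
  "colours ws = card (fst ` set ws)"

definition centred :: "'j \<times> 'i list \<Rightarrow> 'a" where
  "centred l = monomial l \<ominus> \<phi> (monomial l) \<odot> \<one>"

lemma p_closed [simp]: "j \<in> J \<Longrightarrow> p j i \<in> carrier A"
  using proj by (auto simp: projection_def)

lemma monomial_closed [simp]: "fst l \<in> J \<Longrightarrow> monomial l \<in> carrier A"
  unfolding monomial_def by (rule list_prod_closed) auto

lemma centred_closed [simp]: "fst l \<in> J \<Longrightarrow> centred l \<in> carrier A"
  by (simp add: centred_def)

lemma functional_centred: "fst l \<in> J \<Longrightarrow> \<phi> (centred l) = 0"
  by (simp add: centred_def functional_minus functional_smult functional_one)

lemma centred_in_generated:
  assumes "fst l \<in> J"
  shows "centred l \<in> generated_subalgebra A (range (p (fst l)))"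
  unfolding generated_subalgebra_def
proof safe
  fix H assume H: "unital_subalgebra A H" and p: "range (p (fst l)) \<subseteq> H"
  then interpret subring H A by (simp add: unital_subalgebra_def)
  have sub: "submodule H complex_ring A" using H by (simp add: unital_subalgebra_def)
  have "list_prod A (map (p (fst l)) is) \<in> H" for "is"
    using p by (induction "is") auto
  then have "monomial l \<in> H" by (simp add: monomial_def)
  moreover have "\<phi> (monomial l) \<odot> \<one> \<in> H"
    by (rule submodule.smult_closed[OF sub]) auto
  ultimately show "centred l \<in> H"
    unfolding centred_def minus_eq
    using submoduleE(3,5)[OF sub] by blast
qed

text \<open>
  This is the only way in which freeness enters.
\<close>

lemma functional_centred_word:
  assumes "coloured_word ws" "distinct_adj (map fst ws)" "ws \<noteq> []"
  shows "\<phi> (list_prod A (map centred ws)) = 0"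
proof -
  have "list_all2 (\<lambda>l x. l \<in> J \<and> x \<in> generated_subalgebra A (range (p l)) \<and> \<phi> x = 0)
          (map fst ws) (map centred ws)"
    using assms(1)
    by (auto simp: list_all2_conv_all_nth coloured_word_def functional_centred
        centred_in_generated)
  then show ?thesis
    using free assms(2,3) unfolding free_families_def free_subalgebras_def by blast
qed

lemma monomial_Cons: "monomial (j, i # is) = p j i \<otimes> monomial (j, is)"
  by (simp add: monomial_def)

lemma monomial_append:
  "j \<in> J \<Longrightarrow> monomial (j, is @ is') = monomial (j, is) \<otimes> monomial (j, is')"
  unfolding monomial_def by (simp, subst list_prod_append) auto

lemma monomial_commute:
  "j \<in> J \<Longrightarrow> p j i \<otimes> monomial (j, is) = monomial (j, is) \<otimes> p j i"
proof (induction "is")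
  case Nil
  then show ?case by (simp add: monomial_def)
next
  case (Cons k "is")
  then have [simp]: "monomial (j, is) \<in> carrier A" by simp
  have "p j i \<otimes> (p j k \<otimes> monomial (j, is)) = p j k \<otimes> (p j i \<otimes> monomial (j, is))"
    using Cons.prems commute[of j i k] by (simp add: m_assoc[symmetric])
  then show ?case
    using Cons by (simp add: monomial_Cons m_assoc)
qed

lemma projection_monomial: "j \<in> J \<Longrightarrow> projection A (monomial (j, is))"
proof (induction "is")
  case Nil
  then show ?case by (simp add: monomial_def projection_one)
next
  case (Cons i "is")
  then show ?case
    by (simp add: monomial_Cons projection_mult proj monomial_commute)
qed

text \<open>
  The monomial is a projection below its first factor, whose expectation is at most \<open>\<epsilon>\<close>.
\<close>

lemma functional_monomial_le:
  assumes "fst l \<in> J" "snd l \<noteq> []"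
  shows "cmod (\<phi> (monomial l)) \<le> \<epsilon>"
proof -
  obtain j i "is" where l: "l = (j, i # is)"
    using assms by (cases l; cases "snd l") auto
  have j: "j \<in> J" using assms l by simp
  have idem: "p j i \<otimes> p j i = p j i" using proj[OF j] by (auto simp: projection_def)
  have m: "monomial (j, is) \<in> carrier A" using j by simp
  have left: "p j i \<otimes> monomial l = monomial l"
    unfolding l monomial_Cons using j m idem by (simp add: m_assoc[symmetric])
  then have "monomial l \<otimes> p j i = monomial l"
    using monomial_commute[OF j, of i "i # is"] l by simp
  with left have "cmod (\<phi> (monomial l)) \<le> Re (\<phi> (p j i))"
    using projection_functional_mono[OF proj[OF j] projection_monomial[OF j]] l by blast
  with small[OF j] show ?thesis by (meson order_trans)
qed

lemma word_prod_closed [simp]: "coloured_word ws \<Longrightarrow> word_prod ws \<in> carrier A"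
  unfolding word_prod_def by (rule list_prod_closed) (auto simp: coloured_word_def)

lemma word_prod_append:
  "coloured_word ws \<Longrightarrow> coloured_word ws' \<Longrightarrow>
    word_prod (ws @ ws') = word_prod ws \<otimes> word_prod ws'"
  unfolding word_prod_def by (simp, subst list_prod_append) (auto simp: coloured_word_def)

lemma coloured_word_simps [simp]:
  "coloured_word []"
  "coloured_word (l # ws) \<longleftrightarrow> fst l \<in> J \<and> snd l \<noteq> [] \<and> coloured_word ws"
  "coloured_word (ws @ ws') \<longleftrightarrow> coloured_word ws \<and> coloured_word ws'"
  by (auto simp: coloured_word_def)

lemma colours_insert: "colours (ws @ l # ws') \<le> Suc (colours (ws @ ws'))"
  by (simp add: colours_def card_insert_if)

text \<open>
  The factors are restored from left to right, with \<open>us\<close> the part already restored. Writing the next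
  centred factor as the difference of a monomial and a scalar gives two terms. The first moves the
  monomial into \<open>us\<close>. In the second the monomial is deleted, which reduces the number of colours by
  at most one and is compensated by the scalar, whose modulus is at most \<open>\<epsilon>\<close>. With \<open>K m\<close> the constant for
  \<open>m\<close> remaining factors, the first term contributes \<open>K m\<close> and the second \<open>K m + C\<close>, where \<open>C\<close>
  accounts for the deleted word itself; so \<open>K (m + 1) = 2 * K m + C\<close>, that is
  \<open>K m = (2 ^ m - 1) * C\<close>.
\<close>

lemma functional_centring_error:
  assumes shorter: "\<And>ws. coloured_word ws \<Longrightarrow> length ws < n \<Longrightarrow>
      cmod (\<phi> (word_prod ws)) \<le> C * \<epsilon> ^ colours ws"
    and C: "0 \<le> C"
  shows "coloured_word (us @ ws) \<Longrightarrow> length (us @ ws) \<le> n \<Longrightarrow>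
    cmod (\<phi> (word_prod us \<otimes> list_prod A (map centred ws)) - \<phi> (word_prod (us @ ws)))
      \<le> (2 ^ length ws - 1) * C * \<epsilon> ^ colours (us @ ws)"
proof (induction ws arbitrary: us)
  case Nil
  then show ?case by simp
next
  case (Cons l ws)
  let ?P = "list_prod A (map centred ws)"
  let ?c = "colours (us @ l # ws)" and ?c' = "colours (us @ ws)"
  have us [simp]: "coloured_word us" and l: "fst l \<in> J" "snd l \<noteq> []"
    and ws: "coloured_word ws" using Cons.prems by auto
  have m [simp]: "monomial l \<in> carrier A" using l by simp
  have P [simp]: "?P \<in> carrier A"
    by (rule list_prod_closed) (use ws in \<open>auto simp: coloured_word_def\<close>)
  have snoc: "word_prod (us @ [l]) = word_prod us \<otimes> monomial l"
    using us l by (subst word_prod_append) (auto simp: word_prod_def)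
  have "word_prod us \<otimes> (centred l \<otimes> ?P)
      = (word_prod us \<otimes> monomial l) \<otimes> ?P \<ominus> \<phi> (monomial l) \<odot> (word_prod us \<otimes> ?P)"
    by (simp add: centred_def minus_eq l_distr r_distr l_minus r_minus m_assoc
        smult_mult_left smult_mult_right)
  then have split: "\<phi> (word_prod us \<otimes> (centred l \<otimes> ?P))
      = \<phi> (word_prod (us @ [l]) \<otimes> ?P) - \<phi> (monomial l) * \<phi> (word_prod us \<otimes> ?P)"
    by (simp add: functional_minus functional_smult snoc)
  have first: "cmod (\<phi> (word_prod (us @ [l]) \<otimes> ?P) - \<phi> (word_prod (us @ l # ws)))
      \<le> (2 ^ length ws - 1) * C * \<epsilon> ^ ?c"
    using Cons.IH[of "us @ [l]"] Cons.prems by simp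
  have "cmod (\<phi> (word_prod us \<otimes> ?P) - \<phi> (word_prod (us @ ws)))
      \<le> (2 ^ length ws - 1) * C * \<epsilon> ^ ?c'"
    by (rule Cons.IH) (use Cons.prems in auto)
  moreover have "cmod (\<phi> (word_prod (us @ ws))) \<le> C * \<epsilon> ^ ?c'"
    by (rule shorter) (use Cons.prems in auto)
  ultimately have "cmod (\<phi> (word_prod us \<otimes> ?P)) \<le> 2 ^ length ws * C * \<epsilon> ^ ?c'"
    using norm_triangle_sub[of "\<phi> (word_prod us \<otimes> ?P)" "\<phi> (word_prod (us @ ws))"]
    by (simp add: algebra_simps)
  then have "cmod (\<phi> (monomial l) * \<phi> (word_prod us \<otimes> ?P))
      \<le> \<epsilon> * (2 ^ length ws * C * \<epsilon> ^ ?c')"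
    unfolding norm_mult
    by (intro mult_mono functional_monomial_le l) (auto simp: eps_nonneg)
  also have "\<dots> = 2 ^ length ws * C * \<epsilon> ^ Suc ?c'" by simp
  also have "\<dots> \<le> 2 ^ length ws * C * \<epsilon> ^ ?c"
    by (intro mult_left_mono power_decreasing colours_insert)
       (auto simp: eps_nonneg eps_le_one C)
  finally have second: "cmod (\<phi> (monomial l) * \<phi> (word_prod us \<otimes> ?P))
      \<le> 2 ^ length ws * C * \<epsilon> ^ ?c" .
  have "\<phi> (word_prod us \<otimes> (centred l \<otimes> ?P)) - \<phi> (word_prod (us @ l # ws))
      = (\<phi> (word_prod (us @ [l]) \<otimes> ?P) - \<phi> (word_prod (us @ l # ws)))
        - \<phi> (monomial l) * \<phi> (word_prod us \<otimes> ?P)"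
    unfolding split by simp
  also have "cmod \<dots> \<le> (2 ^ length ws - 1) * C * \<epsilon> ^ ?c + 2 ^ length ws * C * \<epsilon> ^ ?c"
    by (rule order_trans[OF norm_triangle_ineq4 add_mono[OF first second]])
  also have "\<dots> = (2 ^ length (l # ws) - 1) * C * \<epsilon> ^ ?c"
    by (simp add: algebra_simps)
  finally show ?case by simp
qed

lemma not_distinct_adj_split:
  "\<not> distinct_adj xs \<Longrightarrow> \<exists>us x vs. xs = us @ x # x # vs"
proof (induction xs rule: induct_list012)
  case (3 x y zs)
  show ?case
  proof (cases "x = y")
    case True
    then show ?thesis by (metis append_Nil)
  next
    case False
    then obtain us z vs where "y # zs = us @ z # z # vs" using 3 by auto
    then show ?thesis by (metis append_Cons)
  qed
qed auto

text \<open>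
  The constant \<open>2 ^ (n * n)\<close> is a convenient solution of \<open>c (n + 1) \<ge> 2 ^ (n + 1) * c n\<close>, which is
  what both cases of the induction require: merging neighbours of equal colour keeps the colours and
  shortens the word, and if neighbouring colours differ, the centred product vanishes, so the word itself
  equals the centring error.
\<close>

lemma functional_word_le:
  "coloured_word ws \<Longrightarrow> cmod (\<phi> (word_prod ws)) \<le> 2 ^ (length ws * length ws) * \<epsilon> ^ colours ws"
proof (induction "length ws" arbitrary: ws rule: less_induct)
  case less
  show ?case
  proof (cases "length ws")
    case 0
    then show ?thesis by (simp add: word_prod_def colours_def functional_one)
  next
    case (Suc n)
    have shorter: "cmod (\<phi> (word_prod vs)) \<le> 2 ^ (n * n) * \<epsilon> ^ colours vs"
      if "coloured_word vs" "length vs < length ws" for vs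
    proof -
      have "length vs * length vs \<le> n * n" using that Suc by (intro mult_mono) auto
      then have "(2::real) ^ (length vs * length vs) \<le> 2 ^ (n * n)"
        by (intro power_increasing) auto
      then have "2 ^ (length vs * length vs) * \<epsilon> ^ colours vs \<le> 2 ^ (n * n) * \<epsilon> ^ colours vs"
        by (intro mult_right_mono) (auto simp: eps_nonneg)
      with less.hyps[OF that(2,1)] show ?thesis by linarith
    qed
    have "cmod (\<phi> (word_prod ws)) \<le> 2 ^ length ws * 2 ^ (n * n) * \<epsilon> ^ colours ws"
    proof (cases "distinct_adj (map fst ws)")
      case True
      have "cmod (\<phi> (word_prod [] \<otimes> list_prod A (map centred ws)) - \<phi> (word_prod ([] @ ws)))
          \<le> (2 ^ length ws - 1) * 2 ^ (n * n) * \<epsilon> ^ colours ([] @ ws)"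
        by (rule functional_centring_error[where n = "length ws"]) (use shorter less.prems in auto)
      moreover have "list_prod A (map centred ws) \<in> carrier A"
        by (rule list_prod_closed) (use less.prems in \<open>auto simp: coloured_word_def\<close>)
      moreover have "\<phi> (list_prod A (map centred ws)) = 0"
        by (rule functional_centred_word) (use less.prems True Suc in auto)
      ultimately have "cmod (\<phi> (word_prod ws))
          \<le> (2 ^ length ws - 1) * 2 ^ (n * n) * \<epsilon> ^ colours ws"
        by (simp add: word_prod_def)
      also have "\<dots> \<le> 2 ^ length ws * 2 ^ (n * n) * \<epsilon> ^ colours ws"
        by (intro mult_right_mono) (auto simp: eps_nonneg)
      finally show ?thesis .
    next
      case False
      then obtain us0 j vs0 where "map fst ws = us0 @ j # j # vs0"
        using not_distinct_adj_split by blast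
      then obtain us is1 is2 vs where ws: "ws = us @ (j, is1) # (j, is2) # vs"
        by (auto simp: map_eq_append_conv map_eq_Cons_conv)
      let ?ws' = "us @ (j, is1 @ is2) # vs"
      have j: "j \<in> J" and valid: "coloured_word us" "coloured_word vs" "is1 \<noteq> []" "is2 \<noteq> []"
        using less.prems ws by auto
      have mono: "monomial (j, is1) \<in> carrier A" "monomial (j, is2) \<in> carrier A"
        "word_prod vs \<in> carrier A"
        using j valid by auto
      have "word_prod ((j, is1) # (j, is2) # vs) = word_prod ((j, is1 @ is2) # vs)"
        using mono by (simp add: word_prod_def monomial_append[OF j] m_assoc)
      then have merged: "word_prod ws = word_prod ?ws'"
        unfolding ws using j valid by (simp add: word_prod_append)
      have same: "colours ws = colours ?ws'"
        by (simp add: ws colours_def)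
      have "cmod (\<phi> (word_prod ?ws')) \<le> 2 ^ (n * n) * \<epsilon> ^ colours ?ws'"
        by (rule shorter) (use j valid ws in auto)
      also have "\<dots> \<le> 2 ^ length ws * 2 ^ (n * n) * \<epsilon> ^ colours ?ws'"
        by (intro mult_right_mono) (auto simp: eps_nonneg)
      finally show ?thesis
        by (simp only: merged same)
    qed
    also have "2 ^ length ws * 2 ^ (n * n) \<le> (2::real) ^ (length ws * length ws)"
      unfolding power_add[symmetric] by (intro power_increasing) (auto simp: Suc)
    then have "2 ^ length ws * 2 ^ (n * n) * \<epsilon> ^ colours ws
        \<le> 2 ^ (length ws * length ws) * \<epsilon> ^ colours ws"
      by (intro mult_right_mono) (auto simp: eps_nonneg)
    finally show ?thesis .
  qed
qed


text \<open>
  Choosing the colour of one more factor: a colour from \<open>C\<close> costs no power of \<open>\<epsilon>\<close>, but there are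
  at most \<open>card C\<close> of these; a new colour costs one factor \<open>\<epsilon>\<close>, which pays for the \<open>card J\<close>
  choices.
\<close>

lemma sum_power_card_insert_le:
  assumes "finite C"
  shows "(\<Sum>j\<in>J. \<epsilon> ^ card (insert j C)) \<le> (real (card C) + real (card J) * \<epsilon>) * \<epsilon> ^ card C"
proof (cases "finite J")
  case True
  have "(\<Sum>j\<in>J. \<epsilon> ^ card (insert j C))
      \<le> (\<Sum>j\<in>J. (if j \<in> C then \<epsilon> ^ card C else 0) + \<epsilon> * \<epsilon> ^ card C)"
    by (rule sum_mono) (use assms in \<open>auto simp: card_insert_if insert_absorb eps_nonneg\<close>)
  also have "\<dots> = real (card (J \<inter> C)) * \<epsilon> ^ card C + real (card J) * (\<epsilon> * \<epsilon> ^ card C)"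
    using True by (simp add: sum.distrib sum.If_cases)
  also have "\<dots> \<le> real (card C) * \<epsilon> ^ card C + real (card J) * (\<epsilon> * \<epsilon> ^ card C)"
    using assms by (intro add_mono mult_right_mono) (auto simp: eps_nonneg intro: card_mono)
  finally show ?thesis by (simp add: algebra_simps)
qed (simp add: eps_nonneg)

definition weighted_sum :: "('i \<Rightarrow> real) \<Rightarrow> 'i \<Rightarrow> 'a" where
  "weighted_sum \<alpha> i = (\<Oplus>j\<in>J. of_real (\<alpha> i) \<odot> p j i)"

lemma weighted_sum_closed: "weighted_sum \<alpha> i \<in> carrier A"
  unfolding weighted_sum_def by (rule finsum_closed) auto

text \<open>
  The sums are expanded one at a time from the left, with \<open>ws\<close> the monomials chosen so far. The number
  of colours of \<open>ws\<close> has to remain in the bound for the induction to see which choices are new.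
\<close>

lemma functional_weighted_sum_word_le:
  assumes fin: "finite J"
  shows "coloured_word ws \<Longrightarrow> length ws + length is \<le> n \<Longrightarrow>
    cmod (\<phi> (word_prod ws \<otimes> list_prod A (map (weighted_sum \<alpha>) is)))
      \<le> 2 ^ (n * n) * (\<Prod>i\<leftarrow>is. \<bar>\<alpha> i\<bar> * (real n + real (card J) * \<epsilon>)) * \<epsilon> ^ colours ws"
proof (induction "is" arbitrary: ws)
  case Nil
  have "length ws * length ws \<le> n * n" using Nil by (intro mult_mono) auto
  then have "(2::real) ^ (length ws * length ws) * \<epsilon> ^ colours ws \<le> 2 ^ (n * n) * \<epsilon> ^ colours ws"
    by (intro mult_right_mono power_increasing) (auto simp: eps_nonneg)
  with functional_word_le[OF Nil(1)] show ?case using Nil by simp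
next
  case (Cons i "is")
  let ?T = "list_prod A (map (weighted_sum \<alpha>) is)"
  let ?K = "2 ^ (n * n) * (\<Prod>i\<leftarrow>is. \<bar>\<alpha> i\<bar> * (real n + real (card J) * \<epsilon>))"
  let ?x = "\<lambda>j. word_prod (ws @ [(j, [i])]) \<otimes> ?T"
  have [simp]: "?T \<in> carrier A"
    by (rule list_prod_closed) (auto simp: weighted_sum_closed)
  have ws [simp]: "coloured_word ws" by fact
  have snoc: "word_prod (ws @ [(j, [i])]) = word_prod ws \<otimes> p j i" if "j \<in> J" for j
    using that by (subst word_prod_append) (auto simp: word_prod_def monomial_def)
  have "weighted_sum \<alpha> i \<otimes> ?T = (\<Oplus>j\<in>J. (of_real (\<alpha> i) \<odot> p j i) \<otimes> ?T)"
    unfolding weighted_sum_def[of \<alpha> i] by (rule finsum_ldistr) (use fin in auto)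
  moreover have "word_prod ws \<otimes> \<dots> = (\<Oplus>j\<in>J. word_prod ws \<otimes> ((of_real (\<alpha> i) \<odot> p j i) \<otimes> ?T))"
    by (rule finsum_rdistr) (use fin in auto)
  ultimately have "word_prod ws \<otimes> (weighted_sum \<alpha> i \<otimes> ?T)
      = (\<Oplus>j\<in>J. word_prod ws \<otimes> ((of_real (\<alpha> i) \<odot> p j i) \<otimes> ?T))"
    by simp
  also have "\<dots> = (\<Oplus>j\<in>J. of_real (\<alpha> i) \<odot> ?x j)"
    by (rule finsum_cong') (auto simp: snoc smult_mult_left smult_mult_right m_assoc)
  finally have "\<phi> (word_prod ws \<otimes> (weighted_sum \<alpha> i \<otimes> ?T)) = (\<Sum>j\<in>J. of_real (\<alpha> i) * \<phi> (?x j))"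
    using fin by (simp add: functional_finsum functional_smult)
  also have "cmod \<dots> \<le> (\<Sum>j\<in>J. \<bar>\<alpha> i\<bar> * (?K * \<epsilon> ^ card (insert j (fst ` set ws))))"
  proof (rule sum_norm_le)
    fix j assume "j \<in> J"
    then have "cmod (\<phi> (?x j)) \<le> ?K * \<epsilon> ^ colours (ws @ [(j, [i])])"
      by (intro Cons.IH) (use Cons.prems in auto)
    then show "cmod (of_real (\<alpha> i) * \<phi> (?x j))
        \<le> \<bar>\<alpha> i\<bar> * (?K * \<epsilon> ^ card (insert j (fst ` set ws)))"
      by (simp add: norm_mult mult_left_mono colours_def)
  qed
  also have "\<dots> = \<bar>\<alpha> i\<bar> * ?K * (\<Sum>j\<in>J. \<epsilon> ^ card (insert j (fst ` set ws)))"
    by (simp add: sum_distrib_left mult.assoc)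
  also have "\<dots> \<le> \<bar>\<alpha> i\<bar> * ?K * ((real n + real (card J) * \<epsilon>) * \<epsilon> ^ colours ws)"
  proof (rule mult_left_mono)
    have "card (fst ` set ws) \<le> n"
      using card_image_le[of "set ws" fst] card_length[of ws] Cons.prems by simp
    then have "(real (card (fst ` set ws)) + real (card J) * \<epsilon>) * \<epsilon> ^ colours ws
        \<le> (real n + real (card J) * \<epsilon>) * \<epsilon> ^ colours ws"
      by (intro mult_right_mono) (auto simp: eps_nonneg)
    with sum_power_card_insert_le[of "fst ` set ws"]
    show "(\<Sum>j\<in>J. \<epsilon> ^ card (insert j (fst ` set ws)))
        \<le> (real n + real (card J) * \<epsilon>) * \<epsilon> ^ colours ws"
      by (simp add: colours_def)
    show "0 \<le> \<bar>\<alpha> i\<bar> * ?K"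
      by (intro mult_nonneg_nonneg prod_list_nonneg) (auto simp: eps_nonneg)
  qed
  finally show ?case by (simp add: mult_ac)
qed

lemma joint_moment_weighted_sum_le:
  assumes "finite J"
  shows "cmod (joint_moment A \<phi> (weighted_sum \<alpha>) is)
    \<le> 2 ^ (length is * length is)
        * (\<Prod>i\<leftarrow>is. \<bar>\<alpha> i\<bar> * (real (length is) + real (card J) * \<epsilon>))"
proof -
  have "list_prod A (map (weighted_sum \<alpha>) is) \<in> carrier A"
    by (rule list_prod_closed) (auto simp: weighted_sum_closed)
  then show ?thesis
    using functional_weighted_sum_word_le[OF assms, of "[]" "is" "length is" \<alpha>]
    by (simp add: joint_moment_def word_prod_def colours_def)
qed

end

section \<open>Extraction of the limit\<close>

theorem theorem2p4:
  fixes \<alpha> lam :: "nat \<Rightarrow> real"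
    and L :: real
    and A :: "nat \<Rightarrow> 'a cstar_record"
    and \<phi> :: "nat \<Rightarrow> 'a \<Rightarrow> complex"
    and p a :: "nat \<Rightarrow> nat \<Rightarrow> nat \<Rightarrow> 'a"
  assumes lam_nonneg: "\<And>i. 0 \<le> lam i"
    and lam_bounded: "bdd_above (range lam)"
    and L_def: "L = (SUP i. lam i)"
    and space: "\<And>N. L < real N \<Longrightarrow> cstar_probability_space (A N) (\<phi> N)"
    and proj: "\<And>N j i. L < real N \<Longrightarrow> j \<in> {1..N} \<Longrightarrow> projection (A N) (p N j i)"
    and commute: "\<And>N j i i'. L < real N \<Longrightarrow> j \<in> {1..N} \<Longrightarrow>
      p N j i \<otimes>\<^bsub>A N\<^esub> p N j i' = p N j i' \<otimes>\<^bsub>A N\<^esub> p N j i"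
    and free: "\<And>N. L < real N \<Longrightarrow> free_families (A N) (\<phi> N) {1..N} (p N)"
    and ident: "\<And>N. L < real N \<Longrightarrow> identically_distributed (A N) (\<phi> N) {1..N} (p N)"
    and expectation: "\<And>N j i. L < real N \<Longrightarrow> j \<in> {1..N} \<Longrightarrow>
      \<phi> N (p N j i) = of_real (lam i / real N)"
    and a_def: "\<And>N j i. L < real N \<Longrightarrow> j \<in> {1..N} \<Longrightarrow>
      a N j i = of_real (\<alpha> i) \<odot>\<^bsub>A N\<^esub> p N j i"
  shows "\<exists>(B :: (complex, nc_polynomial) module) (\<psi> :: nc_polynomial \<Rightarrow> complex)
            (b :: nat \<Rightarrow> nc_polynomial) (n :: nat \<Rightarrow> nat).
      nc_probability_space B \<psi> \<and> (\<forall>i. b i \<in> carrier B) \<and>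
      (\<forall>k. L < real (n k)) \<and> filterlim n at_top sequentially \<and>
      converges_in_distribution (\<lambda>k. A (n k)) (\<lambda>k. \<phi> (n k))
        (\<lambda>k i. \<Oplus>\<^bsub>A (n k)\<^esub>j\<in>{1..n k}. a (n k) j i) B \<psi> b"
proof -
  have lam_le: "lam i \<le> L" for i
    unfolding L_def by (rule cSUP_upper) (use lam_bounded in auto)
  have L_nonneg: "0 \<le> L" using lam_nonneg[of 0] lam_le[of 0] by linarith
  define s where "s N i = (\<Oplus>\<^bsub>A N\<^esub>j\<in>{1..N}. a N j i)" for N i
  define mom where "mom N = joint_moment (A N) (\<phi> N) (s N)" for N
  (* The summand 1 only makes the bound positive, so that it can be divided by: some of the
     weights may vanish. *)
  define bound where "bound is = 1 + 2 ^ (length is * length is)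
      * (\<Prod>i\<leftarrow>is. \<bar>\<alpha> i\<bar> * (real (length is) + L))" for "is"
  have bound_pos: "0 < bound is" for "is"
    unfolding bound_def using L_nonneg
    by (intro add_pos_nonneg mult_nonneg_nonneg prod_list_nonneg) auto
  have mom_le: "cmod (mom N is) \<le> bound is" if N: "L < real N" for N "is"
  proof -
    have N0: "0 < real N" using N L_nonneg by linarith
    interpret cstar_probability_space "A N" "\<phi> N" by (rule space[OF N])
    interpret small_free_projections "A N" "\<phi> N" "{1..N}" "p N" "L / real N"
    proof
      show "Re (\<phi> N (p N j i)) \<le> L / real N" if "j \<in> {1..N}" for j i
        using expectation[OF N that, of i] lam_le[of i] N0 by (simp add: divide_right_mono)
    qed (use N N0 L_nonneg proj commute free in auto)
    have "s N = weighted_sum \<alpha>"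
    proof
      show "s N i = weighted_sum \<alpha> i" for i
        unfolding s_def weighted_sum_def by (rule finsum_cong') (use N a_def in auto)
    qed
    then have "mom N is = joint_moment (A N) (\<phi> N) (weighted_sum \<alpha>) is"
      by (simp only: mom_def)
    with joint_moment_weighted_sum_le[of \<alpha> "is"] N0 show ?thesis
      by (simp add: bound_def)
  qed
  obtain M where M: "L < real M" using reals_Archimedean2 by blast
  (* Normalising turns the bounds, which depend on the word, into a single one; a diagonal
     argument then gives one subsequence for all of the countably many words. *)
  have "cmod (mom (M + k) is / of_real (bound is)) \<le> 1" for k "is"
    using mom_le[of "M + k" "is"] M bound_pos[of "is"] by (simp add: norm_divide)
  then obtain r where r: "strict_mono (r :: nat \<Rightarrow> nat)"
    and "\<exists>l. (\<lambda>k. mom (M + r k) is / of_real (bound is)) \<longlonglongrightarrow> l" for "is"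
  proof (rule_tac function_convergent_subsequence
      [of UNIV "\<lambda>k is. mom (M + k) is / of_real (bound is)" 1])
    fix k :: "nat \<Rightarrow> nat"
    assume k: "strict_mono k"
      and lim: "\<And>is. is \<in> UNIV \<Longrightarrow> \<exists>l. (\<lambda>n. mom (M + k n) is / of_real (bound is)) \<longlonglongrightarrow> l"
    show thesis by (rule that[OF k]) (rule lim[OF UNIV_I])
  qed auto
  then obtain l where l: "(\<lambda>k. mom (M + r k) is / of_real (bound is)) \<longlonglongrightarrow> l is" for "is"
    by metis
  define m where "m is = l is * of_real (bound is)" for "is"
  have lim: "(\<lambda>k. mom (M + r k) is) \<longlonglongrightarrow> m is" for "is"
    using tendsto_mult_right[OF l[of "is"], of "of_real (bound is)"] bound_pos[of "is"]
    by (simp add: m_def)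
  have "mom (M + r k) [] = 1" for k
  proof -
    interpret cstar_probability_space "A (M + r k)" "\<phi> (M + r k)"
      by (rule space) (use M in simp)
    show ?thesis by (simp add: mom_def joint_moment_def functional_one)
  qed
  with lim[of "[]"] have "m [] = 1" by (simp add: LIMSEQ_const_iff)
  then have "nc_probability_space free_algebra (moment_functional m)"
    by (rule nc_probability_space_free_algebra)
  moreover have "filterlim (\<lambda>k. M + r k) at_top sequentially"
    by (rule filterlim_at_top_mono[OF filterlim_ident])
       (use seq_suble[OF r] in \<open>auto intro!: always_eventually trans_le_add2\<close>)
  moreover have "converges_in_distribution (\<lambda>k. A (M + r k)) (\<lambda>k. \<phi> (M + r k))
      (\<lambda>k i. \<Oplus>\<^bsub>A (M + r k)\<^esub>j\<in>{1..M + r k}. a (M + r k) j i)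
      free_algebra (moment_functional m) indeterminate"
    unfolding converges_in_distribution_def joint_moment_indeterminate
    using lim unfolding mom_def s_def[abs_def] by simp
  ultimately show ?thesis
    using M indeterminate_in_carrier
    by (intro exI[of _ free_algebra] exI[of _ "moment_functional m"] exI[of _ indeterminate]
        exI[of _ "\<lambda>k. M + r k"]) auto
qed

end
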